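(* Let $n\ge 2$ be an integer and let $\lambda\in(0,1)$. Then $$\sum_{k=1}^{n-1}\left(M\left(\left[\frac{n-1}{k}\right]\right)\lambda^{n-k+1}\right)\ >\ \lambda^{n+1}.$$
   Context: Here $\mu$ denotes the Möbius function on the positive integers: $\mu(1)=1$; $\mu(m)=0$ if $m$ is divisible by the square of an integer greater than $1$; and $\mu(m)=(-1)^r$ if $m$ is the product of $r$ pairwise distinct primes. The Mertens function is $M(N)=\sum_{m=1}^{N}\mu(m)$ for positive integers $N$. For positive integers $a,k$ with $k\le a$, $\left[\frac{a}{k}\right]$ denotes the largest integer $j$ with $j\le \frac{a}{k}$ (the floor). *)

theory Defs
  imports Complex_Main "HOL-Computational_Algebra.Computational_Algebra"
begin

(* The value at 0 is the junk value 0, since 0 is not squarefree. *)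
definition moebius_mu :: "nat \<Rightarrow> int" where
  "moebius_mu m = (if squarefree m then (-1) ^ card (prime_factors m) else 0)"

definition mertens :: "nat \<Rightarrow> int" where
  "mertens N = (\<Sum>m = 1..N. moebius_mu m)"

lemma moebius_mu_1: "moebius_mu 1 = 1"
  by (simp add: moebius_mu_def)

lemma moebius_mu_square_dvd:
  assumes "d > 1" "d\<^sup>2 dvd m"
  shows "moebius_mu m = 0"
  using assms by (auto simp: moebius_mu_def squarefree_def)

lemma moebius_mu_prod_primes:
  assumes "finite P" "\<And>p. p \<in> P \<Longrightarrow> prime p"
  shows "moebius_mu (\<Prod>P) = (-1) ^ card P"
proof -
  have "squarefree (\<Prod>P)"
    using assms
    by (intro squarefree_prod_coprime) (auto intro: primes_coprime squarefree_prime)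
  moreover have "prime_factors (\<Prod>P) = P"
  proof -
    have "0 \<notin> P"
      using assms(2) by fastforce
    then have "prime_factors (\<Prod>P) = (\<Union>p\<in>P. prime_factors p)"
      using assms(1) by (subst prime_factors_prod) auto
    also have "\<dots> = (\<Union>p\<in>P. {p})"
      using assms(2) by (intro SUP_cong refl) (auto simp: prime_prime_factors)
    finally show ?thesis by simp
  qed
  ultimately show ?thesis
    by (simp add: moebius_mu_def)
qed

end

theory Submission
  imports Defs
begin

text \<open>
  With \<open>N = n - 1\<close> and \<open>x = 1 / \<lambda> > 1\<close>, the claim is \<open>\<Sum>k\<le>N. M(N div k) x ^ k > 1\<close>, and the left-hand
  side is \<open>\<Sum>j\<le>N. P\<^sub>j(x)\<close> with \<open>P\<^sub>j(x) = \<Sum>d | d dvd j. \<mu>(d) x ^ (j div d)\<close>.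
  Here \<open>P\<^sub>1(x) = x > 1\<close>. Expanding \<open>x ^ (j div d) = exp (j ln x / d)\<close> as a power series in \<open>ln x\<close>, the
  coefficient of \<open>(ln x) ^ r / r!\<close> in \<open>P\<^sub>j(x)\<close> is the Jordan totient
  \<open>j ^ r (\<Prod>p | p dvd j. 1 - p powr -r) \<ge> 0\<close>, so \<open>P\<^sub>j(x) \<ge> 0\<close>.
\<close>

text \<open>Half of the bijection between squarefree divisors and sets of prime divisors;
  \<open>prime_factors_prod_primes\<close> is the other half.\<close>

lemma prod_prime_factors_squarefree:
  fixes d :: nat
  assumes "squarefree d"
  shows "\<Prod>(prime_factors d) = d"
proof -
  have "d \<noteq> 0"
    using assms by (metis not_squarefree_0)
  then have "(\<Prod>p\<in>prime_factors d. p ^ multiplicity p d) = d"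
    using prod_prime_factors[of d] by simp
  moreover have "multiplicity p d = 1" if "p \<in> prime_factors d" for p
    using assms \<open>d \<noteq> 0\<close> that squarefree_factorial_semiring' by blast
  ultimately show ?thesis by simp
qed

lemma prime_factors_prod_primes:
  fixes P :: "nat set"
  assumes "finite P" "\<And>p. p \<in> P \<Longrightarrow> prime p"
  shows "prime_factors (\<Prod>P) = P"
proof -
  have "0 \<notin> P"
    using assms(2) by fastforce
  then have "prime_factors (\<Prod>P) = (\<Union>p\<in>P. prime_factors p)"
    using assms(1) by (subst prime_factors_prod) auto
  also have "\<dots> = (\<Union>p\<in>P. {p})"
    using assms(2) by (intro SUP_cong refl) (auto simp: prime_prime_factors)
  finally show ?thesis by simp
qed

lemma prod_primes_dvd:
  fixes n :: nat
  assumes "S \<subseteq> prime_factors n"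
  shows "\<Prod>S dvd n"
proof (cases "n = 0")
  case False
  have "\<Prod>S dvd \<Prod>(prime_factors n)"
    using assms by (intro prod_dvd_prod_subset) auto
  also have "\<dots> dvd (\<Prod>p\<in>prime_factors n. p ^ multiplicity p n)"
    by (intro prod_dvd_prod dvd_power) (auto simp: prime_factors_multiplicity)
  also have "\<dots> = n"
    using False prod_prime_factors[of n] by simp
  finally show ?thesis .
qed simp

text \<open>Only squarefree divisors contribute, and each is the product of a unique set of primes
  dividing \<open>n\<close>. The subset sum has the shape of an expanded product over
  primes.\<close>

lemma sum_moebius_mu_divisors:
  fixes f :: "nat \<Rightarrow> 'a::comm_ring_1"
  assumes "n > 0"
  shows "(\<Sum>d | d dvd n. of_int (moebius_mu d) * f d)
       = (\<Sum>S\<in>Pow (prime_factors n). (-1) ^ card S * f (\<Prod>S))"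
proof -
  have primes: "prime p" if "S \<in> Pow (prime_factors n)" "p \<in> S" for S p
    using that by auto
  have fin: "finite S" if "S \<in> Pow (prime_factors n)" for S
    using that by (auto intro: finite_subset)
  have "(\<Sum>d | d dvd n. of_int (moebius_mu d) * f d)
      = (\<Sum>d | d dvd n \<and> squarefree d. of_int (moebius_mu d) * f d)"
    using assms by (intro sum.mono_neutral_right) (auto simp: moebius_mu_def)
  also have "\<dots> = (\<Sum>S\<in>Pow (prime_factors n). (-1) ^ card S * f (\<Prod>S))"
  proof (rule sum.reindex_bij_witness[of _ "\<lambda>S. \<Prod>S" prime_factors])
    fix S assume S: "S \<in> Pow (prime_factors n)"
    have mu: "moebius_mu (\<Prod>S) = (-1) ^ card S"
      using fin[OF S] primes[OF S] by (rule moebius_mu_prod_primes)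
    show "prime_factors (\<Prod>S) = S"
      using fin[OF S] primes[OF S] by (rule prime_factors_prod_primes)
    \<comment> \<open>By \<open>mu\<close> the value is 1 or -1, whereas \<open>moebius_mu\<close>
      vanishes off the squarefree numbers.\<close>
    have "squarefree (\<Prod>S)"
      using mu by (auto simp: moebius_mu_def split: if_splits)
    then show "\<Prod>S \<in> {d. d dvd n \<and> squarefree d}"
      using S by (auto intro: prod_primes_dvd)
  next
    fix d assume d: "d \<in> {d. d dvd n \<and> squarefree d}"
    then show "\<Prod>(prime_factors d) = d"
      by (simp add: prod_prime_factors_squarefree)
    then show "(-1) ^ card (prime_factors d) * f (\<Prod>(prime_factors d)) = of_int (moebius_mu d) * f d"
      using d by (simp add: moebius_mu_def)
    show "prime_factors d \<in> Pow (prime_factors n)"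
      using d assms dvd_prime_factors[of n d] by simp
  qed
  finally show ?thesis .
qed

lemma sum_moebius_mu_div_power_nonneg:
  assumes "n > 0"
  shows "(\<Sum>d | d dvd n. of_int (moebius_mu d) * (1 / real d) ^ r) \<ge> 0"
proof -
  have "(\<Sum>d | d dvd n. of_int (moebius_mu d) * (1 / real d) ^ r)
      = (\<Sum>S\<in>Pow (prime_factors n). (-1) ^ card S * (\<Prod>p\<in>S. (1 / real p) ^ r))"
  proof -
    have "(1 / real (\<Prod>S)) ^ r = (\<Prod>p\<in>S. (1 / real p) ^ r)" for S
      by (simp add: power_one_over prod_dividef prod_power_distrib)
    then show ?thesis
      using sum_moebius_mu_divisors[OF assms, of "\<lambda>d. (1 / real d) ^ r"] by (simp only:)
  qed
  \<comment> \<open>Multiplying out the product, \<open>S\<close> is the set of primes from whose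
    factor the second term is taken.\<close>
  also have "\<dots> = (\<Prod>p\<in>prime_factors n. 1 - (1 / real p) ^ r)"
    by (subst prod_diff_conv_sum) simp_all
  also have "\<dots> \<ge> 0"
    by (intro prod_nonneg) (auto intro!: power_le_one dest!: in_prime_factors_imp_prime prime_gt_0_nat)
  finally show ?thesis .
qed

lemma sum_moebius_mu_power_nonneg:
  fixes x :: real
  assumes "n > 0" "x \<ge> 1"
  shows "(\<Sum>d | d dvd n. of_int (moebius_mu d) * x ^ (n div d)) \<ge> 0"
proof -
  \<comment> \<open>Chosen so that \<open>exp (t / real d) = x ^ (n div d)\<close> for every divisor
    \<open>d\<close>; \<open>x \<ge> 1\<close> makes the powers of \<open>t\<close>
    nonnegative.\<close>
  define t where "t = real n * ln x"
  have "t \<ge> 0"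
    using assms by (simp add: t_def)
  have "(\<lambda>r. (t / real d) ^ r /\<^sub>R fact r) sums x ^ (n div d)" if "d dvd n" for d
  proof -
    have "t / real d = real (n div d) * ln x"
      using that by (simp add: t_def real_of_nat_div)
    then have "exp (t / real d) = x ^ (n div d)"
      using assms by (simp add: exp_of_nat_mult)
    then show ?thesis
      using exp_converges[of "t / real d"] by (simp only:)
  qed
  then have "(\<lambda>r. \<Sum>d | d dvd n. of_int (moebius_mu d) * ((t / real d) ^ r /\<^sub>R fact r))
      sums (\<Sum>d | d dvd n. of_int (moebius_mu d) * x ^ (n div d))"
    by (intro sums_sum sums_mult) (simp only: mem_Collect_eq)
  moreover have "(\<Sum>d | d dvd n. of_int (moebius_mu d) * ((t / real d) ^ r /\<^sub>R fact r)) \<ge> 0" for r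
  proof -
    \<comment> \<open>The dependence on \<open>d\<close> separates from
      \<open>t ^ r / fact r\<close>, leaving the Euler product with exponent
      \<open>r\<close>.\<close>
    have "(\<Sum>d | d dvd n. of_int (moebius_mu d) * ((t / real d) ^ r /\<^sub>R fact r))
        = t ^ r / fact r * (\<Sum>d | d dvd n. of_int (moebius_mu d) * (1 / real d) ^ r)"
      by (simp add: sum_distrib_left field_simps)
    then show ?thesis
      using sum_moebius_mu_div_power_nonneg[OF assms(1)] \<open>t \<ge> 0\<close> by simp
  qed
  ultimately show ?thesis
    by (rule sums_le[OF _ sums_zero, rotated])
qed

text \<open>Both sides sum over the pairs \<open>(k, m)\<close> with \<open>k * m \<le> N\<close>,
  grouped by \<open>k\<close> on the left and by the product \<open>j = k * m\<close> on the right,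
  where \<open>d = m\<close>.\<close>

lemma sum_mertens_power:
  fixes x :: "'a::comm_ring_1"
  shows "(\<Sum>k = 1..N. of_int (mertens (N div k)) * x ^ k)
       = (\<Sum>j = 1..N. \<Sum>d | d dvd j. of_int (moebius_mu d) * x ^ (j div d))"
proof -
  have le: "k \<le> N" if "d > 0" "d * k \<le> N" for d k
    using that by (intro order_trans[OF _ that(2)]) simp
  have "(\<Sum>k = 1..N. of_int (mertens (N div k)) * x ^ k)
      = (\<Sum>k = 1..N. \<Sum>m = 1..N div k. of_int (moebius_mu m) * x ^ k)"
    by (simp add: mertens_def sum_distrib_right)
  also have "\<dots> = (\<Sum>(k, m)\<in>(SIGMA k:{1..N}. {1..N div k}). of_int (moebius_mu m) * x ^ k)"
    by (rule sum.Sigma) auto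
  also have "\<dots> = (\<Sum>(j, d)\<in>(SIGMA j:{1..N}. {d. d dvd j}). of_int (moebius_mu d) * x ^ (j div d))"
    by (rule sum.reindex_bij_witness[of _ "\<lambda>(j, d). (j div d, d)" "\<lambda>(k, m). (k * m, m)"])
       (auto simp: less_eq_div_iff_mult_less_eq mult.commute Suc_le_eq intro: le elim!: dvdE)
  also have "\<dots> = (\<Sum>j = 1..N. \<Sum>d | d dvd j. of_int (moebius_mu d) * x ^ (j div d))"
    by (rule sum.Sigma[symmetric]) auto
  finally show ?thesis .
qed

text \<open>The strict inequality comes from the term \<open>j = 1\<close>, which is
  \<open>x\<close>; the other terms can only add to it.\<close>

lemma sum_mertens_power_gt_1:
  fixes x :: real
  assumes "N \<ge> 1" "x > 1"
  shows "(\<Sum>k = 1..N. of_int (mertens (N div k)) * x ^ k) > 1"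
proof -
  let ?P = "\<lambda>j. \<Sum>d | d dvd j. of_int (moebius_mu d) * x ^ (j div d)"
  have "1 < ?P 1"
    using assms moebius_mu_1 by simp
  also have "?P 1 \<le> (\<Sum>j = 1..N. ?P j)"
    using assms by (intro member_le_sum sum_moebius_mu_power_nonneg) auto
  finally show ?thesis
    by (simp only: sum_mertens_power)
qed

theorem theorem1p3:
  fixes n :: nat and lam :: real
  assumes "n \<ge> 2" and "lam \<in> {0<..<1}"
  shows "(\<Sum>k = 1..n - 1.
            of_int (mertens (nat \<lfloor>real (n - 1) / real k\<rfloor>)) * lam ^ (n - k + 1)) > lam ^ (n + 1)"
proof -
  have "lam > 0" "lam < 1"
    using assms(2) by auto
  \<comment> \<open>Pull out \<open>lam ^ (n + 1)\<close> to reach \<open>x = 1 / lam\<close>. Since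
    \<open>k \<le> n - 1\<close>, the truncated subtraction \<open>n - k\<close> is exact.\<close>
  have "(\<Sum>k = 1..n - 1.
            of_int (mertens (nat \<lfloor>real (n - 1) / real k\<rfloor>)) * lam ^ (n - k + 1))
      = (\<Sum>k = 1..n - 1. lam ^ (n + 1) * (of_int (mertens ((n - 1) div k)) * (1 / lam) ^ k))"
  proof (rule sum.cong)
    fix k assume "k \<in> {1..n - 1}"
    then have "n - k + 1 = n + 1 - k" "k \<le> n + 1"
      by auto
    then have "lam ^ (n - k + 1) = lam ^ (n + 1) * (1 / lam) ^ k"
      using \<open>lam > 0\<close> power_diff[of lam k "n + 1"]
      by (simp only: power_one_over times_divide_eq_right mult_1_right)
    moreover have "nat \<lfloor>real (n - 1) / real k\<rfloor> = (n - 1) div k"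
      by (simp only: floor_divide_of_nat_eq nat_int)
    ultimately show "of_int (mertens (nat \<lfloor>real (n - 1) / real k\<rfloor>)) * lam ^ (n - k + 1)
        = lam ^ (n + 1) * (of_int (mertens ((n - 1) div k)) * (1 / lam) ^ k)"
      by (metis mult.left_commute)
  qed simp
  also have "\<dots> = lam ^ (n + 1) * (\<Sum>k = 1..n - 1. of_int (mertens ((n - 1) div k)) * (1 / lam) ^ k)"
    by (simp only: sum_distrib_left)
  also have "\<dots> > lam ^ (n + 1)"
    using sum_mertens_power_gt_1[of "n - 1" "1 / lam"] assms(1) \<open>lam > 0\<close> \<open>lam < 1\<close> by simp
  finally show ?thesis .
qed

end
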